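(* For any convex body $K \subseteq \mathbb{R}^n$ we have $c''(K) = c'(K)$.
   Context: A convex body $K \subseteq \mathbb{R}^n$ is a compact convex set with nonempty interior. A point $y \in \mathbb{R}^n \setminus K$ c-illuminates a point $x \in K$ if there exists $\varepsilon > 0$ with $x + \varepsilon (x-y) \in \mathrm{int}(K)$. Define $$c'(K) = \min\{m : \exists y_1,\dots,y_m \in \mathbb{R}^n \setminus K \ \forall x \in K \ \exists i \ (y_i \text{ c-illuminates } x)\}.$$ A point $y \in \mathbb{R}^n \setminus K$ t-c-illuminates a point $x \in K$ if there exists $\varepsilon > 0$ with $x + \varepsilon (x-y) \in K$. Define $$c''(K) = \min\{m : \exists y_1,\dots,y_m \in \mathbb{R}^n \setminus K \ \forall x \in K \ \exists i \ (y_i \text{ t-c-illuminates } x)\}.$$ *)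

theory Defs
  imports "HOL-Analysis.Analysis"
begin

definition convex_body :: "'a::euclidean_space set \<Rightarrow> bool" where
  "convex_body K \<longleftrightarrow> compact K \<and> convex K \<and> interior K \<noteq> {}"

(* Both relations are meant for y outside K and x in K; these side conditions
   are imposed where the relations are used below. *)

definition c_illuminates :: "'a::euclidean_space set \<Rightarrow> 'a \<Rightarrow> 'a \<Rightarrow> bool" where
  "c_illuminates K y x \<longleftrightarrow> (\<exists>\<epsilon>>0. x + \<epsilon> *\<^sub>R (x - y) \<in> interior K)"

definition tc_illuminates :: "'a::euclidean_space set \<Rightarrow> 'a \<Rightarrow> 'a \<Rightarrow> bool" where
  "tc_illuminates K y x \<longleftrightarrow> (\<exists>\<epsilon>>0. x + \<epsilon> *\<^sub>R (x - y) \<in> K)"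

(* c' and c''.  For a convex body K (in positive dimension) a finite system of points as
   required exists by compactness, so each LEAST is a genuine minimum. *)

definition c_illumination_number :: "'a::euclidean_space set \<Rightarrow> nat" where
  "c_illumination_number K =
     (LEAST m. \<exists>y :: nat \<Rightarrow> 'a. (\<forall>i\<in>{1..m}. y i \<notin> K) \<and>
        (\<forall>x\<in>K. \<exists>i\<in>{1..m}. c_illuminates K (y i) x))"

definition tc_illumination_number :: "'a::euclidean_space set \<Rightarrow> nat" where
  "tc_illumination_number K =
     (LEAST m. \<exists>y :: nat \<Rightarrow> 'a. (\<forall>i\<in>{1..m}. y i \<notin> K) \<and>
        (\<forall>x\<in>K. \<exists>i\<in>{1..m}. tc_illuminates K (y i) x))"

end

theory Submission
  imports Defs
begin

text \<open>
  Moving a light source away from an interior point turns weak illumination into strict illumination.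
  Fix \<open>p\<close> in the interior of \<open>K\<close> and replace a source \<open>y\<close> by the reflection of \<open>p\<close> in \<open>y\<close>, the
  point \<open>y' = 2 y - p\<close>. The direction in which \<open>y'\<close> lights \<open>x\<close> is
  \<open>x - y' = 2 (x - y) + (p - x)\<close>. If \<open>y\<close> t-c-illuminates \<open>x\<close>, then \<open>x - y\<close> leads from \<open>x\<close> into
  \<open>K\<close>, and the extra summand \<open>p - x\<close> pushes the ray into the interior
  (\<open>c_illuminates_reflection\<close>). Moreover \<open>y'\<close> stays outside \<open>K\<close>, because \<open>y\<close> is the midpoint
  of \<open>y'\<close> and \<open>p\<close> and \<open>K\<close> is convex (\<open>reflection_notin_convex\<close>). One and the same \<open>p\<close> serves
  all sources, so a t-c-illuminating system becomes a c-illuminating system of the same size. The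
  converse needs no change of the sources. Hence the two minima range over the same set of sizes.
\<close>

lemma c_illuminates_imp_tc_illuminates:
  "c_illuminates K y x \<Longrightarrow> tc_illuminates K y x"
  unfolding c_illuminates_def tc_illuminates_def using interior_subset by blast

lemma reflection_notin_convex:
  assumes "convex K" "p \<in> K" "y \<notin> K"
  shows "2 *\<^sub>R y - p \<notin> K"
proof
  assume "2 *\<^sub>R y - p \<in> K"
  then have "(1/2) *\<^sub>R (2 *\<^sub>R y - p) + (1/2) *\<^sub>R p \<in> K"
    using assms by (intro convexD) auto
  then show False
    using \<open>y \<notin> K\<close> by (simp add: algebra_simps)
qed

text \<open>
  A short step from \<open>x\<close> away from \<open>2 y - p\<close> ends at a proper convex combination of \<open>p\<close> with a
  point of \<open>K\<close> on the ray from \<open>x\<close> away from \<open>y\<close>. A convex combination that gives positive weight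
  to an interior point is interior.
\<close>

lemma c_illuminates_reflection:
  assumes "convex K" "p \<in> interior K" "tc_illuminates K y x"
  shows "c_illuminates K (2 *\<^sub>R y - p) x"
proof -
  obtain e where e: "e > 0" and z: "x + e *\<^sub>R (x - y) \<in> K"
    using assms(3) unfolding tc_illuminates_def by blast
  let ?z = "x + e *\<^sub>R (x - y)"
  \<comment> \<open>The weight \<open>t\<close> of \<open>p\<close> solves \<open>(1 - t) e = 2 t\<close>, which makes the coefficients of
    \<open>x - y\<close> and \<open>p - x\<close> proportional to \<open>2\<close> and \<open>1\<close>.\<close>
  define t where "t = e / (2 + e)"
  have t: "0 < t" "t \<le> 1" and weight: "(1 - t) * e = 2 * t"
    using e by (auto simp: t_def field_simps)
  have "?z - t *\<^sub>R (?z - p) \<in> interior K"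
    using mem_interior_convex_shrink[OF assms(1,2) z t] .
  also have "?z - t *\<^sub>R (?z - p) = x + ((1 - t) * e) *\<^sub>R (x - y) + t *\<^sub>R (p - x)"
    by (simp add: algebra_simps)
  also have "\<dots> = x + t *\<^sub>R (x - (2 *\<^sub>R y - p))"
    unfolding weight by (simp add: algebra_simps flip: scaleR_2)
  finally show ?thesis
    using t(1) unfolding c_illuminates_def by blast
qed

theorem theorem3p1:
  fixes K :: "(real ^ 'n) set"
  assumes "convex_body K"
  shows "tc_illumination_number K = c_illumination_number K"
proof -
  obtain p where K: "convex K" and p: "p \<in> interior K"
    using assms unfolding convex_body_def by blast
  have p_in: "p \<in> K"
    using p interior_subset by blast
  have "(\<exists>y :: nat \<Rightarrow> real ^ 'n. (\<forall>i\<in>{1..m}. y i \<notin> K) \<and>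
          (\<forall>x\<in>K. \<exists>i\<in>{1..m}. tc_illuminates K (y i) x)) \<longleftrightarrow>
        (\<exists>y :: nat \<Rightarrow> real ^ 'n. (\<forall>i\<in>{1..m}. y i \<notin> K) \<and>
          (\<forall>x\<in>K. \<exists>i\<in>{1..m}. c_illuminates K (y i) x))" (is "?weak \<longleftrightarrow> ?strict") for m
  proof
    assume ?weak
    then obtain y :: "nat \<Rightarrow> real ^ 'n" where
      outside: "\<forall>i\<in>{1..m}. y i \<notin> K" and
      lit: "\<forall>x\<in>K. \<exists>i\<in>{1..m}. tc_illuminates K (y i) x"
      by blast
    have "\<forall>i\<in>{1..m}. 2 *\<^sub>R y i - p \<notin> K"
      using outside reflection_notin_convex[OF K p_in] by blast
    moreover have "\<forall>x\<in>K. \<exists>i\<in>{1..m}. c_illuminates K (2 *\<^sub>R y i - p) x"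
      using lit c_illuminates_reflection[OF K p] by blast
    ultimately show ?strict
      by (intro exI[of _ "\<lambda>i. 2 *\<^sub>R y i - p"] conjI)
  next
    assume ?strict
    then show ?weak
      using c_illuminates_imp_tc_illuminates by blast
  qed
  then show ?thesis
    unfolding tc_illumination_number_def c_illumination_number_def by simp
qed

end
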